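(* Let $G\leq\operatorname{Aut}(T)$ be a branch group and let $W$ be a weakly maximal subgroup of $G$. Then at least one of the following holds: (1) all the subgroups $\operatorname{Rist}_W(v)$, for $v$ a vertex of $T$, are infinite; (2) the action $W\curvearrowright\partial T$ has a finite number of orbit-closures.
   Context: $T$ is a rooted tree; all rooted trees are infinite and spherically regular (the number of children of a vertex depends only on its level), and every vertex has at least two children. $\operatorname{Aut}(T)$ is the group of graph automorphisms fixing the root; $\mathcal L_n$ is the set of vertices of level $n$; $T_v$ is the subtree of descendants of $v$. The boundary $\partial T$ is the set of infinite rays starting at the root, with the metric in which two distinct rays first differing at index $i$ are at distance $2^{-i}$; an orbit-closure is the closure in $\partial T$ of an orbit. For $H\le\operatorname{Aut}(T)$, $\operatorname{Rist}_H(v)$ is the subgroup of elements of $H$ acting trivially outside $T_v$, and $\operatorname{Rist}_H(\mathcal L_n)=\prod_{v\in\mathcal L_n}\operatorname{Rist}_H(v)$. $G$ is branch if it acts transitively on every $\mathcal L_n$ and $\operatorname{Rist}_G(\mathcal L_n)$ has finite index in $G$ for every $n$. A subgroup is weakly maximal if it is maximal among the subgroups of infinite index of $G$. *)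

theory Defs
  imports
    "HOL-Analysis.Abstract_Metric_Spaces"
    "HOL-Library.Equipollence"
    "HOL-Algebra.Algebra"
begin

text \<open>
  The vertices of the tree are all the elements of the type \<open>'v\<close>, so that automorphisms are plain
  permutations of a type and need no convention outside a carrier.
\<close>

record 'v rooted_graph =
  adj :: "'v \<Rightarrow> 'v \<Rightarrow> bool"
  root :: "'v"

definition path_between :: "('v, 'z) rooted_graph_scheme \<Rightarrow> 'v \<Rightarrow> 'v list \<Rightarrow> 'v \<Rightarrow> bool" where
  "path_between T u p v \<longleftrightarrow>
     p \<noteq> [] \<and> hd p = u \<and> last p = v \<and> distinct p \<and> successively (adj T) p"

definition rooted_tree :: "('v, 'z) rooted_graph_scheme \<Rightarrow> bool" where
  "rooted_tree T \<longleftrightarrow>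
     symp (adj T) \<and> irreflp (adj T) \<and> (\<forall>u v. \<exists>!p. path_between T u p v)"

definition root_path :: "('v, 'z) rooted_graph_scheme \<Rightarrow> 'v \<Rightarrow> 'v list" where
  "root_path T v = (THE p. path_between T (root T) p v)"

definition level :: "('v, 'z) rooted_graph_scheme \<Rightarrow> 'v \<Rightarrow> nat" where
  "level T v = length (root_path T v) - 1"

definition level_set :: "('v, 'z) rooted_graph_scheme \<Rightarrow> nat \<Rightarrow> 'v set" where
  "level_set T n = {v. level T v = n}"

definition subtree :: "('v, 'z) rooted_graph_scheme \<Rightarrow> 'v \<Rightarrow> 'v set" where
  "subtree T v = {w. v \<in> set (root_path T w)}"

definition children :: "('v, 'z) rooted_graph_scheme \<Rightarrow> 'v \<Rightarrow> 'v set" where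
  "children T v = {w \<in> subtree T v. adj T v w}"

text \<open>
  The number of children is compared as a cardinal: local finiteness is not assumed (it
  follows as soon as a branch group acts on the tree).  Infiniteness of the tree follows from the
  last conjunct.
\<close>

definition spherically_regular_tree :: "('v, 'z) rooted_graph_scheme \<Rightarrow> bool" where
  "spherically_regular_tree T \<longleftrightarrow>
     rooted_tree T \<and>
     (\<forall>u v. level T u = level T v \<longrightarrow> children T u \<approx> children T v) \<and>
     (\<forall>v. \<exists>a\<in>children T v. \<exists>b\<in>children T v. a \<noteq> b)"

definition Aut :: "('v, 'z) rooted_graph_scheme \<Rightarrow> ('v \<Rightarrow> 'v) monoid" where
  "Aut T =
     \<lparr>carrier = {f. bij f \<and> (\<forall>u v. adj T (f u) (f v) \<longleftrightarrow> adj T u v) \<and> f (root T) = root T},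
      monoid.mult = (\<circ>),
      monoid.one = id\<rparr>"

lemma group_Aut: "group (Aut T)"
proof (rule groupI)
  fix f assume f: "f \<in> carrier (Aut T)"
  then have b: "bij f" by (simp add: Aut_def)
  have inv: "f (inv_into UNIV f x) = x" "inv_into UNIV f (f x) = x" for x
    using b by (simp_all add: bij_is_surj bij_is_inj surj_f_inv_f)
  have "adj T (inv_into UNIV f u) (inv_into UNIV f v) \<longleftrightarrow> adj T u v" for u v
  proof -
    have "adj T (f (inv_into UNIV f u)) (f (inv_into UNIV f v)) \<longleftrightarrow>
        adj T (inv_into UNIV f u) (inv_into UNIV f v)"
      using f by (simp add: Aut_def)
    then show ?thesis by (simp add: inv)
  qed
  moreover have "inv_into UNIV f (root T) = root T"
  proof -
    have "f (root T) = root T" using f by (simp add: Aut_def)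
    then show ?thesis using inv(2)[of "root T"] by simp
  qed
  ultimately have "inv_into UNIV f \<in> carrier (Aut T)"
    using b by (simp add: Aut_def bij_imp_bij_inv)
  moreover have "inv_into UNIV f \<circ> f = id"
    using b by (simp add: bij_is_inj)
  ultimately show "\<exists>g\<in>carrier (Aut T). g \<otimes>\<^bsub>Aut T\<^esub> f = \<one>\<^bsub>Aut T\<^esub>"
    by (auto simp: Aut_def)
qed (auto simp: Aut_def bij_comp comp_assoc)

definition Rist :: "('v, 'z) rooted_graph_scheme \<Rightarrow> ('v \<Rightarrow> 'v) set \<Rightarrow> 'v \<Rightarrow> ('v \<Rightarrow> 'v) set" where
  "Rist T H v = {h \<in> H. \<forall>w. w \<notin> subtree T v \<longrightarrow> h w = w}"

text \<open>
  The rigid stabilizers of the vertices of one level commute pairwise and intersect trivially;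
  their (internal) product is the subgroup they generate.
\<close>

definition Rist_level :: "('v, 'z) rooted_graph_scheme \<Rightarrow> ('v \<Rightarrow> 'v) set \<Rightarrow> nat \<Rightarrow> ('v \<Rightarrow> 'v) set"
  where "Rist_level T H n = generate (Aut T) (\<Union>v\<in>level_set T n. Rist T H v)"

definition finite_index :: "('a, 'b) monoid_scheme \<Rightarrow> 'a set \<Rightarrow> bool" where
  "finite_index G H \<longleftrightarrow> finite (rcosets\<^bsub>G\<^esub> H)"

definition branch_group :: "('v, 'z) rooted_graph_scheme \<Rightarrow> ('v \<Rightarrow> 'v) set \<Rightarrow> bool" where
  "branch_group T G \<longleftrightarrow>
     subgroup G (Aut T) \<and>
     (\<forall>n. \<forall>u\<in>level_set T n. \<forall>v\<in>level_set T n. \<exists>g\<in>G. g u = v) \<and>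
     (\<forall>n. finite_index (Aut T\<lparr>carrier := G\<rparr>) (Rist_level T G n))"

definition weakly_maximal :: "('a, 'b) monoid_scheme \<Rightarrow> 'a set \<Rightarrow> bool" where
  "weakly_maximal G W \<longleftrightarrow>
     subgroup W G \<and> \<not> finite_index G W \<and>
     (\<forall>K. subgroup K G \<and> W \<subset> K \<longrightarrow> finite_index G K)"

definition boundary :: "('v, 'z) rooted_graph_scheme \<Rightarrow> (nat \<Rightarrow> 'v) set" where
  "boundary T = {\<xi>. \<xi> 0 = root T \<and> inj \<xi> \<and> (\<forall>i. adj T (\<xi> i) (\<xi> (Suc i)))}"

definition ray_dist :: "(nat \<Rightarrow> 'v) \<Rightarrow> (nat \<Rightarrow> 'v) \<Rightarrow> real" where
  "ray_dist \<xi> \<eta> = (if \<xi> = \<eta> then 0 else (1/2) ^ (LEAST i. \<xi> i \<noteq> \<eta> i))"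

lemma Metric_space_boundary: "Metric_space (boundary T) ray_dist"
proof
  fix \<xi> \<eta> \<zeta> :: "nat \<Rightarrow> 'a"
  show "0 \<le> ray_dist \<xi> \<eta>" by (simp add: ray_dist_def)
  show "ray_dist \<xi> \<eta> = ray_dist \<eta> \<xi>" by (simp add: ray_dist_def eq_commute)
  show "ray_dist \<xi> \<eta> = 0 \<longleftrightarrow> \<xi> = \<eta>" by (simp add: ray_dist_def)
  show "ray_dist \<xi> \<zeta> \<le> ray_dist \<xi> \<eta> + ray_dist \<eta> \<zeta>"
  proof (cases "\<xi> = \<eta> \<or> \<eta> = \<zeta> \<or> \<xi> = \<zeta>")
    case True
    then show ?thesis by (auto simp: ray_dist_def)
  next
    case False
    define d where "d \<alpha> \<beta> = (LEAST i. \<alpha> i \<noteq> \<beta> i)" for \<alpha> \<beta> :: "nat \<Rightarrow> 'a"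
    have "\<exists>i. \<xi> i \<noteq> \<zeta> i" using False by auto
    then have "\<xi> (d \<xi> \<zeta>) \<noteq> \<zeta> (d \<xi> \<zeta>)" unfolding d_def by (rule LeastI_ex)
    then consider "\<xi> (d \<xi> \<zeta>) \<noteq> \<eta> (d \<xi> \<zeta>)" | "\<eta> (d \<xi> \<zeta>) \<noteq> \<zeta> (d \<xi> \<zeta>)" by fastforce
    then have "(1/2::real) ^ d \<xi> \<zeta> \<le> (1/2) ^ d \<xi> \<eta> + (1/2) ^ d \<eta> \<zeta>"
    proof cases
      case 1
      then have "d \<xi> \<eta> \<le> d \<xi> \<zeta>" unfolding d_def[of \<xi> \<eta>] by (rule Least_le)
      then have "(1/2::real) ^ d \<xi> \<zeta> \<le> (1/2) ^ d \<xi> \<eta>" by (intro power_decreasing) auto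
      then show ?thesis by (rule order_trans) simp
    next
      case 2
      then have "d \<eta> \<zeta> \<le> d \<xi> \<zeta>" unfolding d_def[of \<eta> \<zeta>] by (rule Least_le)
      then have "(1/2::real) ^ d \<xi> \<zeta> \<le> (1/2) ^ d \<eta> \<zeta>" by (intro power_decreasing) auto
      then show ?thesis by (rule order_trans) simp
    qed
    then show ?thesis using False by (simp add: ray_dist_def d_def)
  qed
qed

definition boundary_topology :: "('v, 'z) rooted_graph_scheme \<Rightarrow> (nat \<Rightarrow> 'v) topology" where
  "boundary_topology T = Metric_space.mtopology (boundary T) ray_dist"

definition ray_orbit :: "('v \<Rightarrow> 'v) set \<Rightarrow> (nat \<Rightarrow> 'v) \<Rightarrow> (nat \<Rightarrow> 'v) set" where
  "ray_orbit H \<xi> = {h \<circ> \<xi> | h. h \<in> H}"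

definition orbit_closures ::
  "('v, 'z) rooted_graph_scheme \<Rightarrow> ('v \<Rightarrow> 'v) set \<Rightarrow> (nat \<Rightarrow> 'v) set set" where
  "orbit_closures T H = {boundary_topology T closure_of ray_orbit H \<xi> | \<xi>. \<xi> \<in> boundary T}"

end

theory Submission
  imports Defs
begin

text \<open>
  Suppose \<open>Rist\<^sub>W(v)\<close> is finite for some \<open>v\<close>; passing to a descendant, it is trivial.
  If \<open>U\<close> is a \<open>W\<close>-invariant set of vertices and some element of \<open>G\<close> outside \<open>W\<close> is supported in
  \<open>U\<close>, then the elements of \<open>G\<close> that agree with an element of \<open>W\<close> outside \<open>U\<close> form a subgroup
  properly containing \<open>W\<close>.  By weak maximality it has finite index, hence a bounded number of orbits
  on the levels, and outside \<open>U\<close> its orbits are those of \<open>W\<close>.  As \<open>Rist\<^sub>G(w)\<close> is nontrivial, this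
  applies to \<open>U = W T\<^sub>w\<close> for every descendant \<open>w\<close> of \<open>v\<close>.  If two descendants of \<open>v\<close> of equal level
  lie in different orbits, the two associated sets \<open>U\<close> are disjoint and so \<open>W\<close> has boundedly many
  orbits on the levels.  Otherwise all of \<open>W T\<^sub>v\<close> contributes only one orbit per level, with the same
  conclusion.  Finally, the closure of the orbit of a ray is determined by the sequence of the orbits
  of its vertices.
\<close>

section \<open>Paths and rays\<close>

lemma path_between_root_path:
  assumes "rooted_tree T"
  shows "path_between T (root T) (root_path T v) v"
  using assms unfolding rooted_tree_def root_path_def by (metis (mono_tags, lifting) theI')

lemma root_path_eqI:
  assumes "rooted_tree T" "path_between T (root T) p v"
  shows "root_path T v = p"
  using assms path_between_root_path[OF assms(1), of v] unfolding rooted_tree_def by metis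

lemma self_in_subtree:
  assumes "rooted_tree T"
  shows "v \<in> subtree T v"
  using path_between_root_path[OF assms, of v] unfolding path_between_def subtree_def
  by (metis last_in_set mem_Collect_eq)

text \<open>An initial segment of the simple path to \<open>w\<close> is again a simple path from
  the root, so uniqueness makes it the root path of its endpoint.\<close>

lemma root_path_nth:
  assumes T: "rooted_tree T" and i: "i < length (root_path T w)"
  shows "root_path T (root_path T w ! i) = take (Suc i) (root_path T w)"
proof (rule root_path_eqI[OF T])
  let ?p = "root_path T w"
  have p: "path_between T (root T) ?p w" by (rule path_between_root_path[OF T])
  have s: "successively (adj T) (take (Suc i) ?p)"
    using p successively_append_iff[of "adj T" "take (Suc i) ?p" "drop (Suc i) ?p"]
    by (simp add: path_between_def)
  have "last (take (Suc i) ?p) = ?p ! i"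
    using i by (simp add: take_Suc_conv_app_nth)
  then show "path_between T (root T) (take (Suc i) ?p) (?p ! i)"
    using p i s by (auto simp: path_between_def)
qed

lemma subtree_trans:
  assumes T: "rooted_tree T" and "u \<in> subtree T v" "w \<in> subtree T u"
  shows "w \<in> subtree T v"
proof -
  obtain i where i: "i < length (root_path T w)" "root_path T w ! i = u"
    using assms(3) by (auto simp: subtree_def in_set_conv_nth)
  then have "root_path T u = take (Suc i) (root_path T w)"
    using root_path_nth[OF T] by metis
  then show ?thesis
    using assms(2) by (auto simp: subtree_def dest: in_set_takeD)
qed

text \<open>Both vertices lie on the root path of \<open>w\<close>, where a vertex sits at the
  position given by its level.\<close>

lemma subtree_disjoint:
  assumes T: "rooted_tree T" and "level T u = level T v" "w \<in> subtree T u" "w \<in> subtree T v"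
  shows "u = v"
proof -
  obtain i where i: "i < length (root_path T w)" "root_path T w ! i = u"
    using assms(3) by (auto simp: subtree_def in_set_conv_nth)
  obtain j where j: "j < length (root_path T w)" "root_path T w ! j = v"
    using assms(4) by (auto simp: subtree_def in_set_conv_nth)
  have "level T u = i" "level T v = j"
    using root_path_nth[OF T] i j by (auto simp: level_def)
  then show ?thesis using assms(2) i j by simp
qed

lemma level_child:
  assumes T: "rooted_tree T" and a: "a \<in> children T v"
  shows "level T a = Suc (level T v)"
proof -
  let ?p = "root_path T a"
  have p: "path_between T (root T) ?p a" by (rule path_between_root_path[OF T])
  have av: "adj T v a" and v: "v \<in> set ?p" using a by (auto simp: children_def subtree_def)
  have ne: "v \<noteq> a" using av T by (auto simp: rooted_tree_def irreflp_def)
  obtain i where i: "i < length ?p" "?p ! i = v" using v by (auto simp: in_set_conv_nth)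
  have r: "root_path T v = take (Suc i) ?p" using root_path_nth[OF T i(1)] i by simp
  have q: "path_between T (root T) (root_path T v) v" by (rule path_between_root_path[OF T])
  \<comment> \<open>The root path of \<open>v\<close> is the prefix of \<open>?p\<close> ending at
    \<open>v\<close>. The vertex \<open>a\<close> occurs in the distinct list \<open>?p\<close> only
    as its last entry, so it could lie in that prefix only if \<open>v = a\<close>.\<close>
  have "a \<notin> set (root_path T v)"
  proof
    assume "a \<in> set (root_path T v)"
    then obtain j where j: "j < length ?p" "j < Suc i" "?p ! j = a"
      using r by (auto simp: in_set_conv_nth)
    have "?p ! (length ?p - 1) = a" using p by (auto simp: path_between_def last_conv_nth)
    moreover have "distinct ?p" using p by (simp add: path_between_def)
    ultimately have "j = length ?p - 1" using j i by (metis nth_eq_iff_index_eq diff_less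
        length_greater_0_conv less_nat_zero_code list.size(3) zero_less_one)
    then have "i = j" using j i by simp
    then show False using i j ne by simp
  qed
  then have "path_between T (root T) (root_path T v @ [a]) a"
    using q av by (auto simp: path_between_def successively_append_iff)
  then have "?p = root_path T v @ [a]" by (rule root_path_eqI[OF T])
  then show ?thesis using q by (auto simp: level_def path_between_def Suc_diff_le Suc_le_eq)
qed

lemma root_path_ray:
  assumes T: "rooted_tree T" and \<xi>: "\<xi> \<in> boundary T"
  shows "root_path T (\<xi> n) = map \<xi> [0..<Suc n]"
proof (rule root_path_eqI[OF T])
  have "successively (adj T) (map \<xi> [0..<Suc n])"
    using \<xi> unfolding boundary_def successively_conv_nth by (auto simp del: upt_Suc)
  moreover have "hd (map \<xi> [0..<Suc n]) = root T"
    using \<xi> by (simp add: boundary_def hd_map del: upt_Suc)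
  moreover have "distinct (map \<xi> [0..<Suc n])"
    using \<xi> by (auto simp: boundary_def distinct_map inj_on_def simp del: upt_Suc)
  ultimately show "path_between T (root T) (map \<xi> [0..<Suc n]) (\<xi> n)"
    unfolding path_between_def by (simp add: last_map)
qed

text \<open>A vertex determines its root path, which is the initial segment of every ray through
  it.\<close>

lemma ray_agree:
  assumes T: "rooted_tree T" and "\<xi> \<in> boundary T" "\<eta> \<in> boundary T" "\<xi> n = \<eta> n" "m \<le> n"
  shows "\<xi> m = \<eta> m"
proof -
  have "map \<xi> [0..<Suc n] = map \<eta> [0..<Suc n]"
    using root_path_ray[OF T] assms(2-4) by metis
  then show ?thesis using \<open>m \<le> n\<close> by (auto simp: map_eq_conv simp del: upt_Suc)
qed

lemma ray_level:
  assumes "rooted_tree T" "\<xi> \<in> boundary T"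
  shows "\<xi> n \<in> level_set T n"
  using root_path_ray[OF assms] by (simp add: level_set_def level_def)

section \<open>Automorphisms\<close>

lemma root_path_Aut:
  assumes T: "rooted_tree T" and f: "f \<in> carrier (Aut T)"
  shows "root_path T (f v) = map f (root_path T v)"
proof (rule root_path_eqI[OF T])
  have "path_between T (root T) (root_path T v) v" by (rule path_between_root_path[OF T])
  then show "path_between T (root T) (map f (root_path T v)) (f v)"
    using f by (auto simp: path_between_def Aut_def successively_map hd_map last_map distinct_map
        bij_def inj_on_def)
qed

lemma level_Aut:
  assumes "rooted_tree T" "f \<in> carrier (Aut T)"
  shows "level T (f v) = level T v"
  using root_path_Aut[OF assms] by (simp add: level_def)

lemma subtree_Aut:
  assumes "rooted_tree T" "f \<in> carrier (Aut T)"
  shows "f w \<in> subtree T (f v) \<longleftrightarrow> w \<in> subtree T v"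
proof -
  have "inj f" using assms(2) by (simp add: Aut_def bij_is_inj)
  then show ?thesis
    using root_path_Aut[OF assms] by (auto simp: subtree_def dest: injD)
qed

lemma ray_Aut:
  assumes "f \<in> carrier (Aut T)" "\<xi> \<in> boundary T"
  shows "f \<circ> \<xi> \<in> boundary T"
  using assms by (auto simp: Aut_def boundary_def bij_is_inj intro: inj_compose)

section \<open>Subgroups of \<open>Aut T\<close> in terms of composition and inverse
  functions\<close>

lemma inv_Aut:
  assumes f: "f \<in> carrier (Aut T)"
  shows "inv\<^bsub>Aut T\<^esub> f = inv_into UNIV f"
proof -
  have "inv\<^bsub>Aut T\<^esub> f \<circ> f = id"
    using group.l_inv[OF group_Aut f] by (simp add: Aut_def)
  moreover have "f \<circ> inv\<^bsub>Aut T\<^esub> f = id"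
    using group.r_inv[OF group_Aut f] by (simp add: Aut_def)
  ultimately show ?thesis
    by (metis inv_unique_comp)
qed

lemma subgroup_AutD:
  assumes H: "subgroup H (Aut T)"
  shows "id \<in> H"
    and "f \<in> H \<Longrightarrow> f \<in> carrier (Aut T)"
    and "f \<in> H \<Longrightarrow> bij f"
    and "f \<in> H \<Longrightarrow> g \<in> H \<Longrightarrow> f \<circ> g \<in> H"
    and "f \<in> H \<Longrightarrow> inv_into UNIV f \<in> H"
    and "f \<in> H \<Longrightarrow> f (inv_into UNIV f x) = x"
    and "f \<in> H \<Longrightarrow> inv_into UNIV f (f x) = x"
proof -
  show c: "f \<in> carrier (Aut T)" if "f \<in> H" for f using subgroup.mem_carrier[OF H that] .
  show b: "bij f" if "f \<in> H" for f using c[OF that] by (simp add: Aut_def)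
  show "id \<in> H" using subgroup.one_closed[OF H] by (simp add: Aut_def)
  show "f \<circ> g \<in> H" if "f \<in> H" "g \<in> H" for f g
    using subgroup.m_closed[OF H that] by (simp add: Aut_def)
  show "inv_into UNIV f \<in> H" if "f \<in> H" for f
    using subgroup.m_inv_closed[OF H that] inv_Aut[OF c[OF that]] by simp
  show "f (inv_into UNIV f x) = x" if "f \<in> H" for f x
    using b[OF that] by (simp add: bij_is_surj surj_f_inv_f)
  show "inv_into UNIV f (f x) = x" if "f \<in> H" for f x
    using b[OF that] by (simp add: bij_is_inj)
qed

lemma subgroup_AutI:
  assumes "H \<subseteq> carrier (Aut T)" "id \<in> H"
    and "\<And>f g. f \<in> H \<Longrightarrow> g \<in> H \<Longrightarrow> f \<circ> g \<in> H"
    and "\<And>f. f \<in> H \<Longrightarrow> inv_into UNIV f \<in> H"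
  shows "subgroup H (Aut T)"
proof (rule group.subgroupI[OF group_Aut])
  show "inv\<^bsub>Aut T\<^esub> f \<in> H" if "f \<in> H" for f
    using assms(1,4) that inv_Aut[of f T] by auto
  show "f \<otimes>\<^bsub>Aut T\<^esub> g \<in> H" if "f \<in> H" "g \<in> H" for f g
    using assms(3)[OF that] by (simp add: Aut_def)
qed (use assms in auto)

section \<open>Orbits\<close>

definition vertex_orbit :: "('v \<Rightarrow> 'v) set \<Rightarrow> 'v \<Rightarrow> 'v set" where
  "vertex_orbit H x = {h x | h. h \<in> H}"

lemma vertex_orbit_eq:
  assumes H: "subgroup H (Aut T)" and h: "h \<in> H"
  shows "vertex_orbit H (h x) = vertex_orbit H x"
proof (intro equalityI subsetI)
  fix y assume "y \<in> vertex_orbit H (h x)"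
  then obtain g where "g \<in> H" "y = (g \<circ> h) x" by (auto simp: vertex_orbit_def)
  then show "y \<in> vertex_orbit H x"
    using subgroup_AutD(4)[OF H _ h] unfolding vertex_orbit_def by blast
next
  fix y assume "y \<in> vertex_orbit H x"
  then obtain g where "g \<in> H" "y = (g \<circ> inv_into UNIV h) (h x)"
    using subgroup_AutD(7)[OF H h] by (auto simp: vertex_orbit_def)
  then show "y \<in> vertex_orbit H (h x)"
    using subgroup_AutD(4)[OF H _ subgroup_AutD(5)[OF H h]] unfolding vertex_orbit_def by blast
qed

lemma self_in_vertex_orbit:
  assumes "subgroup H (Aut T)"
  shows "x \<in> vertex_orbit H x"
  using subgroup_AutD(1)[OF assms] unfolding vertex_orbit_def by (auto intro!: exI[of _ id])

lemma vertex_orbit_eq_iff: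
  assumes H: "subgroup H (Aut T)"
  shows "vertex_orbit H x = vertex_orbit H y \<longleftrightarrow> (\<exists>h\<in>H. h x = y)"
proof
  assume "vertex_orbit H x = vertex_orbit H y"
  then have "y \<in> vertex_orbit H x" using self_in_vertex_orbit[OF H] by simp
  then show "\<exists>h\<in>H. h x = y" by (auto simp: vertex_orbit_def)
qed (auto simp: vertex_orbit_eq[OF H])

text \<open>The bound is uniform over all levels. Finiteness is stated separately because
  \<open>card\<close> is 0 on infinite sets. The set \<open>A\<close> allows orbits to be counted
  separately on an invariant set and on its complement.\<close>

definition bounded_orbits :: "'v rooted_graph \<Rightarrow> ('v \<Rightarrow> 'v) set \<Rightarrow> 'v set \<Rightarrow> bool" where
  "bounded_orbits T H A \<longleftrightarrow>
     (\<exists>N. \<forall>n. finite (vertex_orbit H ` (level_set T n \<inter> A)) \<and>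
              card (vertex_orbit H ` (level_set T n \<inter> A)) \<le> N)"

lemma bounded_orbits_Un:
  assumes "bounded_orbits T H A" "bounded_orbits T H B"
  shows "bounded_orbits T H (A \<union> B)"
proof -
  obtain N where N: "\<And>n. finite (vertex_orbit H ` (level_set T n \<inter> A))"
      "\<And>n. card (vertex_orbit H ` (level_set T n \<inter> A)) \<le> N"
    using assms(1) by (auto simp: bounded_orbits_def)
  obtain M where M: "\<And>n. finite (vertex_orbit H ` (level_set T n \<inter> B))"
      "\<And>n. card (vertex_orbit H ` (level_set T n \<inter> B)) \<le> M"
    using assms(2) by (auto simp: bounded_orbits_def)
  have "vertex_orbit H ` (level_set T n \<inter> (A \<union> B)) =
      vertex_orbit H ` (level_set T n \<inter> A) \<union> vertex_orbit H ` (level_set T n \<inter> B)" for n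
    by auto
  moreover have "card (E \<union> F) \<le> N + M" if "card E \<le> N" "card F \<le> M" for E F :: "'a set set"
    using card_Un_le[of E F] that by linarith
  ultimately show ?thesis
    unfolding bounded_orbits_def using N M by (intro exI[of _ "N + M"]) auto
qed

lemma bounded_orbits_mono:
  assumes "bounded_orbits T H B" "A \<subseteq> B"
  shows "bounded_orbits T H A"
proof -
  obtain N where N: "\<And>n. finite (vertex_orbit H ` (level_set T n \<inter> B))"
      "\<And>n. card (vertex_orbit H ` (level_set T n \<inter> B)) \<le> N"
    using assms(1) by (auto simp: bounded_orbits_def)
  have "vertex_orbit H ` (level_set T n \<inter> A) \<subseteq> vertex_orbit H ` (level_set T n \<inter> B)" for n
    using assms(2) by auto
  then show ?thesis
    unfolding bounded_orbits_def
    by (intro exI[of _ N]) (meson N card_mono finite_subset le_trans)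
qed

text \<open>Fix a vertex \<open>x\<close> of level \<open>n\<close>. By transitivity each vertex of
  that level is some \<open>g x\<close>, and its \<open>K\<close>-orbit is the set of values at
  \<open>x\<close> of the coset \<open>K g\<close>. Hence each level has at most as many orbits as
  there are cosets.\<close>

lemma finite_index_bounded_orbits:
  fixes T :: "'v rooted_graph"
  assumes trans: "\<forall>n. \<forall>u\<in>level_set T n. \<forall>v\<in>level_set T n. \<exists>g\<in>G. g u = v"
    and fin: "finite_index (Aut T\<lparr>carrier := G\<rparr>) K"
  shows "bounded_orbits T K UNIV"
proof -
  let ?C = "rcosets\<^bsub>Aut T\<lparr>carrier := G\<rparr>\<^esub> K"
  have fC: "finite ?C" using fin by (simp add: finite_index_def)
  have "vertex_orbit K ` level_set T n \<subseteq> (\<lambda>c. (\<lambda>f. f x) ` c) ` ?C" if x: "x \<in> level_set T n" for n x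
  proof
    fix o' assume "o' \<in> vertex_orbit K ` level_set T n"
    then obtain y where y: "y \<in> level_set T n" "o' = vertex_orbit K y" by auto
    obtain g where g: "g \<in> G" "g x = y" using trans x y by blast
    let ?c = "K #>\<^bsub>Aut T\<lparr>carrier := G\<rparr>\<^esub> g"
    have "?c \<in> ?C" using g by (auto simp: RCOSETS_def)
    moreover have "o' = (\<lambda>f. f x) ` ?c"
      using y g by (auto simp: r_coset_def vertex_orbit_def Aut_def image_UN)
    ultimately show "o' \<in> (\<lambda>c. (\<lambda>f. f x) ` c) ` ?C" by blast
  qed
  then have "finite (vertex_orbit K ` level_set T n) \<and> card (vertex_orbit K ` level_set T n) \<le> card ?C"
    for n
  \<comment> \<open>Without a vertex there is no base point \<open>x\<close>, but also no orbit to
    count.\<close>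
  proof (cases "level_set T n = {}")
    case False
    then obtain x where "x \<in> level_set T n" by blast
    note s = \<open>\<And>n x. x \<in> level_set T n \<Longrightarrow> _\<close>[OF this]
    show ?thesis using finite_surj[OF fC s] surj_card_le[OF fC s] by blast
  qed simp
  then show ?thesis by (auto simp: bounded_orbits_def)
qed

text \<open>The invariance of \<open>U\<close> makes \<open>K\<close> below a group, and
  \<open>g\<close> makes it larger than \<open>W\<close>. The bound for \<open>K\<close> then passes
  to \<open>W\<close> outside \<open>U\<close>, where both have the same orbits.\<close>

lemma weakly_maximal_bounded_orbits:
  fixes T :: "'v rooted_graph"
  assumes G: "subgroup G (Aut T)"
    and trans: "\<forall>n. \<forall>u\<in>level_set T n. \<forall>v\<in>level_set T n. \<exists>g\<in>G. g u = v"
    and wm: "weakly_maximal (Aut T\<lparr>carrier := G\<rparr>) W"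
    and inv: "\<And>h x. h \<in> W \<Longrightarrow> h x \<in> U \<longleftrightarrow> x \<in> U"
    and g: "g \<in> G" "g \<notin> W" "\<And>x. x \<notin> U \<Longrightarrow> g x = x"
  shows "bounded_orbits T W (- U)"
proof -
  have W: "subgroup W (Aut T)"
    using wm group.incl_subgroup[OF group_Aut G] by (auto simp: weakly_maximal_def)
  have WG: "W \<subseteq> G"
    using wm subgroup.subset by (fastforce simp: weakly_maximal_def)
  define K where "K = {f \<in> G. \<exists>h\<in>W. \<forall>x. x \<notin> U \<longrightarrow> f x = h x}"
  have K: "subgroup K (Aut T)"
  proof (rule subgroup_AutI)
    show "K \<subseteq> carrier (Aut T)" using subgroup_AutD(2)[OF G] by (auto simp: K_def)
    show "id \<in> K" using subgroup_AutD(1)[OF G] subgroup_AutD(1)[OF W]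
      by (auto simp: K_def intro!: bexI[of _ id])
  next
    fix f f' assume f: "f \<in> K" and f': "f' \<in> K"
    obtain h where h: "h \<in> W" "\<And>x. x \<notin> U \<Longrightarrow> f x = h x" using f by (auto simp: K_def)
    obtain h' where h': "h' \<in> W" "\<And>x. x \<notin> U \<Longrightarrow> f' x = h' x" using f' by (auto simp: K_def)
    \<comment> \<open>The point \<open>h' x\<close> is still outside \<open>U\<close>, so
      \<open>f\<close> moves it as \<open>h\<close> does.\<close>
    have "\<And>x. x \<notin> U \<Longrightarrow> (f \<circ> f') x = (h \<circ> h') x" using h h' inv by simp
    then show "f \<circ> f' \<in> K"
      using subgroup_AutD(4)[OF W h(1) h'(1)] subgroup_AutD(4)[OF G, of f f'] f f'
      unfolding K_def by blast
  next
    fix f assume f: "f \<in> K"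
    obtain h where h: "h \<in> W" "\<And>x. x \<notin> U \<Longrightarrow> f x = h x" using f by (auto simp: K_def)
    have fG: "f \<in> G" using f by (simp add: K_def)
    have hi: "inv_into UNIV h \<in> W" by (rule subgroup_AutD(5)[OF W h(1)])
    have "inv_into UNIV f x = inv_into UNIV h x" if "x \<notin> U" for x
    proof -
      have "f (inv_into UNIV h x) = x"
        using h(2) inv[OF hi] that subgroup_AutD(6)[OF W h(1)] by simp
      then show ?thesis using subgroup_AutD(7)[OF G fG] by metis
    qed
    then show "inv_into UNIV f \<in> K"
      using subgroup_AutD(5)[OF G fG] hi unfolding K_def by blast
  qed
  have "K \<subseteq> G" by (auto simp: K_def)
  then have KG: "subgroup K (Aut T\<lparr>carrier := G\<rparr>)"
    by (rule group.subgroup_incl[OF group_Aut K G])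
  \<comment> \<open>Outside \<open>U\<close> the element \<open>g\<close> agrees with the identity,
    which lies in \<open>W\<close>.\<close>
  have "g \<in> K" using g subgroup_AutD(1)[OF W] by (auto simp: K_def intro!: bexI[of _ id])
  moreover have "W \<subseteq> K" using WG by (auto simp: K_def)
  ultimately have "W \<subset> K" using g by blast
  then have "finite_index (Aut T\<lparr>carrier := G\<rparr>) K" using wm KG by (auto simp: weakly_maximal_def)
  then have "bounded_orbits T K UNIV" by (rule finite_index_bounded_orbits[OF trans])
  then have "bounded_orbits T K (- U)" by (rule bounded_orbits_mono) simp
  moreover have "vertex_orbit K x = vertex_orbit W x" if "x \<notin> U" for x
    using that \<open>W \<subseteq> K\<close> by (force simp: vertex_orbit_def K_def)
  then have "vertex_orbit K ` (level_set T n \<inter> - U) = vertex_orbit W ` (level_set T n \<inter> - U)" for n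
    by (intro image_cong) auto
  ultimately show ?thesis by (simp add: bounded_orbits_def)
qed

section \<open>Orbit closures\<close>

text \<open>Given \<open>N + 1\<close> distinct sequences, choose an index beyond a place of
  difference for every pair. By coherence they are pairwise distinct there, against the bound
  \<open>N\<close>.\<close>

lemma finite_bounded_projections:
  fixes S :: "(nat \<Rightarrow> 'a) set"
  assumes bd: "\<And>n. finite ((\<lambda>s. s n) ` S) \<and> card ((\<lambda>s. s n) ` S) \<le> N"
    and coh: "\<And>s t m n. s \<in> S \<Longrightarrow> t \<in> S \<Longrightarrow> s n = t n \<Longrightarrow> m \<le> n \<Longrightarrow> s m = t m"
  shows "finite S"
proof (rule ccontr)
  assume "infinite S"
  then obtain F where F: "F \<subseteq> S" "finite F" "card F = Suc N"
    using infinite_arbitrarily_large by blast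
  have "\<forall>s t :: nat \<Rightarrow> 'a. \<exists>i. s \<noteq> t \<longrightarrow> s i \<noteq> t i" by auto
  then obtain d where d: "\<And>s t :: nat \<Rightarrow> 'a. s \<noteq> t \<Longrightarrow> s (d s t) \<noteq> t (d s t)" by metis
  define n where "n = Max ((\<lambda>(s, t). d s t) ` (F \<times> F))"
  have n: "d s t \<le> n" if "s \<in> F" "t \<in> F" for s t
    unfolding n_def using F that by (intro Max_ge) auto
  have "inj_on (\<lambda>s. s n) F"
  proof (rule inj_onI)
    fix s t assume st: "s \<in> F" "t \<in> F" "s n = t n"
    then have "s (d s t) = t (d s t)" using coh n F by blast
    then show "s = t" using d by blast
  qed
  then have "Suc N = card ((\<lambda>s. s n) ` F)" using F by (simp add: card_image)
  also have "\<dots> \<le> card ((\<lambda>s. s n) ` S)" using bd F by (intro card_mono) auto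
  also have "\<dots> \<le> N" using bd by blast
  finally show False by simp
qed

text \<open>Rays that have separated never meet again, so agreeing at \<open>n\<close> means first
  differing after \<open>n\<close>. Thus the ball of radius \<open>(1/2) ^ n\<close> around \<xi>
  consists of the rays through \<open>\<xi> n\<close>.\<close>

lemma ray_dist_less_iff:
  assumes T: "rooted_tree T" and "\<xi> \<in> boundary T" "\<eta> \<in> boundary T"
  shows "ray_dist \<xi> \<eta> < (1/2) ^ n \<longleftrightarrow> \<xi> n = \<eta> n"
proof (cases "\<xi> = \<eta>")
  case False
  define k where "k = (LEAST i. \<xi> i \<noteq> \<eta> i)"
  have "\<exists>i. \<xi> i \<noteq> \<eta> i" using False by auto
  then have k: "\<xi> k \<noteq> \<eta> k" unfolding k_def by (rule LeastI_ex)
  have "\<xi> n = \<eta> n \<longleftrightarrow> n < k"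
    using ray_agree[OF assms, of n k] k not_le[of k n] not_less_Least[of n "\<lambda>i. \<xi> i \<noteq> \<eta> i"]
    by (auto simp: k_def[symmetric])
  moreover have "(1/2::real) ^ k < (1/2) ^ n \<longleftrightarrow> n < k"
    by (rule power_strict_decreasing_iff) auto
  ultimately show ?thesis using False by (simp add: ray_dist_def k_def)
qed (simp add: ray_dist_def)

text \<open>By the description of balls, \<open>x\<close> is in the closure iff for each
  \<open>n\<close> some \<open>h\<close>, possibly depending on \<open>n\<close>, sends
  \<open>\<xi> n\<close> to \<open>x n\<close>.\<close>

lemma closure_of_ray_orbit:
  assumes T: "rooted_tree T" and H: "subgroup H (Aut T)" and \<xi>: "\<xi> \<in> boundary T"
  shows "boundary_topology T closure_of ray_orbit H \<xi> =
    {x \<in> boundary T. \<forall>n. x n \<in> vertex_orbit H (\<xi> n)}"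
proof -
  interpret Metric_space "boundary T" ray_dist by (rule Metric_space_boundary)
  have hb: "h \<circ> \<xi> \<in> boundary T" if "h \<in> H" for h
    using ray_Aut subgroup_AutD(2)[OF H that] \<xi> by blast
  have "(\<forall>r>0. \<exists>y\<in>ray_orbit H \<xi>. y \<in> mball x r) \<longleftrightarrow> (\<forall>n. x n \<in> vertex_orbit H (\<xi> n))"
    if x: "x \<in> boundary T" for x
  proof (intro iffI allI impI)
    fix n assume "\<forall>r>0. \<exists>y\<in>ray_orbit H \<xi>. y \<in> mball x r"
    then have "\<exists>y\<in>ray_orbit H \<xi>. y \<in> mball x ((1/2) ^ n)"
      by (rule allE[of _ "(1/2) ^ n"]) simp
    then obtain h where h: "h \<in> H" "ray_dist x (h \<circ> \<xi>) < (1/2) ^ n"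
      by (auto simp: ray_orbit_def)
    then have "x n = h (\<xi> n)" using ray_dist_less_iff[OF T x hb] by simp
    then show "x n \<in> vertex_orbit H (\<xi> n)" using h by (auto simp: vertex_orbit_def)
  next
    fix r :: real assume all: "\<forall>n. x n \<in> vertex_orbit H (\<xi> n)" and r: "0 < r"
    obtain n where n: "(1/2) ^ n < r" using real_arch_pow_inv[OF r, of "1/2"] by auto
    obtain h where h: "h \<in> H" "x n = h (\<xi> n)" using all unfolding vertex_orbit_def by blast
    then have "ray_dist x (h \<circ> \<xi>) < (1/2) ^ n" using ray_dist_less_iff[OF T x hb] by simp
    then have "h \<circ> \<xi> \<in> mball x r" using n x hb h by simp
    then show "\<exists>y\<in>ray_orbit H \<xi>. y \<in> mball x r" using h by (auto simp: ray_orbit_def)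
  qed
  then show ?thesis
    unfolding boundary_topology_def metric_closure_of by blast
qed

lemma finite_orbit_closures:
  assumes T: "rooted_tree T" and H: "subgroup H (Aut T)" and bd: "bounded_orbits T H UNIV"
  shows "finite (orbit_closures T H)"
proof -
  \<comment> \<open>An orbit closure depends only on the sequence of vertex orbits met by the ray,
    so it is enough to count these sequences.\<close>
  define S where "S = (\<lambda>\<xi> n. vertex_orbit H (\<xi> n)) ` boundary T"
  obtain N where N: "\<And>n. finite (vertex_orbit H ` level_set T n)"
      "\<And>n. card (vertex_orbit H ` level_set T n) \<le> N"
    using bd by (auto simp: bounded_orbits_def)
  have "finite S"
  proof (rule finite_bounded_projections)
    fix n
    have "(\<lambda>s. s n) ` S \<subseteq> vertex_orbit H ` level_set T n"
      using ray_level[OF T] by (auto simp: S_def)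
    then show "finite ((\<lambda>s. s n) ` S) \<and> card ((\<lambda>s. s n) ` S) \<le> N"
      by (meson N card_mono finite_subset le_trans)
  next
    fix s t and m n :: nat assume s: "s \<in> S" and t: "t \<in> S" and eq: "s n = t n" and mn: "m \<le> n"
    obtain \<xi> \<eta> where x: "\<xi> \<in> boundary T" "s = (\<lambda>n. vertex_orbit H (\<xi> n))"
      and y: "\<eta> \<in> boundary T" "t = (\<lambda>n. vertex_orbit H (\<eta> n))" using s t by (auto simp: S_def)
    obtain h where h: "h \<in> H" "(h \<circ> \<xi>) n = \<eta> n"
      using eq x y vertex_orbit_eq_iff[OF H] by auto
    \<comment> \<open>Coherence: an element carrying \<open>\<xi> n\<close> to
      \<open>\<eta> n\<close> carries the whole initial segment along.\<close>
    have "(h \<circ> \<xi>) m = \<eta> m"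
      using ray_agree[OF T ray_Aut[OF subgroup_AutD(2)[OF H h(1)] x(1)] y(1) h(2) mn] .
    then show "s m = t m" using x y h vertex_orbit_eq_iff[OF H] by auto
  qed
  moreover have "orbit_closures T H = (\<lambda>s. {x \<in> boundary T. \<forall>n. x n \<in> s n}) ` S"
    unfolding orbit_closures_def S_def image_image
    using closure_of_ray_orbit[OF T H] by (auto simp: setcompr_eq_image)
  ultimately show ?thesis by simp
qed

section \<open>Rigid stabilizers\<close>

lemma Rist_mono:
  assumes "rooted_tree T" "w \<in> subtree T v"
  shows "Rist T H w \<subseteq> Rist T H v"
  using subtree_trans[OF assms] by (auto simp: Rist_def)

text \<open>Take \<open>w\<close> below \<open>v\<close> with the fewest elements in
  \<open>Rist T H w\<close>. By minimality the children of \<open>w\<close> have this same set, so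
  its elements are supported in two disjoint subtrees.\<close>

lemma Rist_finite_imp_trivial_descendant:
  assumes T: "spherically_regular_tree T" and fin: "finite (Rist T H v)"
  obtains w where "w \<in> subtree T v" "Rist T H w \<subseteq> {id}"
proof -
  have rt: "rooted_tree T" using T by (simp add: spherically_regular_tree_def)
  obtain w where w: "w \<in> subtree T v"
    and min: "\<And>u. u \<in> subtree T v \<Longrightarrow> card (Rist T H w) \<le> card (Rist T H u)"
    using ex_has_least_nat[of "\<lambda>u. u \<in> subtree T v" v "\<lambda>u. card (Rist T H u)"]
      self_in_subtree[OF rt] by blast
  have finw: "finite (Rist T H w)" using Rist_mono[OF rt w] fin finite_subset by blast
  obtain a b where ab: "a \<in> children T w" "b \<in> children T w" "a \<noteq> b"
    using T by (meson spherically_regular_tree_def)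
  have eq: "Rist T H c = Rist T H w" if "c \<in> children T w" for c
  proof -
    have c: "c \<in> subtree T w" using that by (simp add: children_def)
    show ?thesis
      using card_seteq[OF finw Rist_mono[OF rt c]] min subtree_trans[OF rt w c] by blast
  qed
  have "g = id" if "g \<in> Rist T H w" for g
  proof
    fix x
    have "x \<notin> subtree T a \<or> x \<notin> subtree T b"
      using subtree_disjoint[OF rt] level_child[OF rt] ab by metis
    then show "g x = id x" using that eq ab by (auto simp: Rist_def)
  qed
  then show ?thesis using w that by blast
qed

text \<open>Transitivity conjugates the rigid stabilizers of one level into each other. If one is
  trivial then so is their product, and its finite index forces \<open>G\<close> to be
  finite.\<close>

lemma Rist_branch_nontrivial:
  assumes T: "rooted_tree T" and G: "branch_group T G" and inf: "infinite G"
  shows "\<not> Rist T G v \<subseteq> {id}"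
proof
  assume triv: "Rist T G v \<subseteq> {id}"
  have sG: "subgroup G (Aut T)" using G by (simp add: branch_group_def)
  have "Rist T G u = {id}" if u: "u \<in> level_set T (level T v)" for u
  proof -
    have "v \<in> level_set T (level T v)" by (simp add: level_set_def)
    then obtain g where g: "g \<in> G" "g v = u" using G u unfolding branch_group_def by blast
    have "f = id" if f: "f \<in> Rist T G u" for f
    proof -
      \<comment> \<open>Since \<open>g\<close> maps the subtree of \<open>v\<close> onto that of
        \<open>u\<close>, this conjugate is supported below \<open>v\<close>.\<close>
      let ?f = "inv_into UNIV g \<circ> (f \<circ> g)"
      have "?f \<in> G"
        using f g subgroup_AutD(4,5)[OF sG] by (simp add: Rist_def)
      moreover have "?f x = x" if "x \<notin> subtree T v" for x
        using that f g subtree_Aut[OF T subgroup_AutD(2)[OF sG g(1)], of x v]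
          subgroup_AutD(7)[OF sG g(1)] by (simp add: Rist_def)
      ultimately have "?f = id" using triv by (auto simp: Rist_def)
      then have "f (g x) = g x" for x
        using subgroup_AutD(6)[OF sG g(1)] by (metis comp_apply id_apply)
      then have "f y = y" for y using subgroup_AutD(6)[OF sG g(1)] by metis
      then show ?thesis by auto
    qed
    moreover have "id \<in> Rist T G u" using subgroup_AutD(1)[OF sG] by (simp add: Rist_def)
    ultimately show ?thesis by blast
  qed
  moreover have "v \<in> level_set T (level T v)" by (simp add: level_set_def)
  ultimately have "(\<Union>u\<in>level_set T (level T v). Rist T G u) = {\<one>\<^bsub>Aut T\<^esub>}"
    by (auto simp: Aut_def)
  then have "Rist_level T G (level T v) = {id}"
    using group.generate_one[OF group_Aut] by (simp add: Rist_level_def Aut_def)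
  then have "finite_index (Aut T\<lparr>carrier := G\<rparr>) {id}" using G by (metis branch_group_def)
  moreover have "rcosets\<^bsub>Aut T\<lparr>carrier := G\<rparr>\<^esub> {id} = (\<lambda>g. {g}) ` G"
    by (auto simp: RCOSETS_def r_coset_def Aut_def)
  ultimately show False
    using inf by (auto simp: finite_index_def dest: finite_imageD)
qed

section \<open>Weakly maximal subgroups with a finite rigid stabilizer\<close>

theorem proposition1p11:
  fixes T :: "'v rooted_graph"
    and G W :: "('v \<Rightarrow> 'v) set"
  assumes "spherically_regular_tree T"
    and "branch_group T G"
    and "weakly_maximal (Aut T\<lparr>carrier := G\<rparr>) W"
  shows "(\<forall>v. infinite (Rist T W v)) \<or> finite (orbit_closures T W)"
proof (unfold disj_imp, rule impI)
  assume "\<not> (\<forall>v. infinite (Rist T W v))"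
  then obtain v where v: "Rist T W v \<subseteq> {id}"
    using Rist_finite_imp_trivial_descendant[OF assms(1)] by metis
  have T: "rooted_tree T" using assms(1) by (simp add: spherically_regular_tree_def)
  have G: "subgroup G (Aut T)"
    and trans: "\<forall>n. \<forall>u\<in>level_set T n. \<forall>v\<in>level_set T n. \<exists>g\<in>G. g u = v"
    using assms(2) by (auto simp: branch_group_def)
  have W: "subgroup W (Aut T)"
    using assms(3) group.incl_subgroup[OF group_Aut G] by (auto simp: weakly_maximal_def)
  have WG: "W \<subseteq> G"
    using assms(3) subgroup.subset by (fastforce simp: weakly_maximal_def)
  \<comment> \<open>A finite group has no subgroup of infinite index.\<close>
  have "infinite G"
  proof
    assume "finite G"
    moreover have "rcosets\<^bsub>Aut T\<lparr>carrier := G\<rparr>\<^esub> W = (\<lambda>g. W #>\<^bsub>Aut T\<lparr>carrier := G\<rparr>\<^esub> g) ` G"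
      by (auto simp: RCOSETS_def)
    ultimately show False using assms(3) by (auto simp: weakly_maximal_def finite_index_def)
  qed
  \<comment> \<open>The union of the \<open>W\<close>-translates of the subtree of \<open>a\<close>,
    the smallest invariant set containing it.\<close>
  define U where "U a = {x. \<exists>h\<in>W. x \<in> subtree T (h a)}" for a
  have U: "bounded_orbits T W (- U a)" if a: "a \<in> subtree T v" for a
  proof -
    obtain g where g: "g \<in> Rist T G a" "g \<noteq> id"
      using Rist_branch_nontrivial[OF T assms(2) \<open>infinite G\<close>] by blast
    show ?thesis
    proof (rule weakly_maximal_bounded_orbits[OF G trans assms(3)])
      have sub: "h x \<in> U a" if h: "h \<in> W" and x: "x \<in> U a" for h x
      proof -
        obtain k where k: "k \<in> W" "x \<in> subtree T (k a)" using x by (auto simp: U_def)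
        then have "h x \<in> subtree T ((h \<circ> k) a)"
          using subtree_Aut[OF T subgroup_AutD(2)[OF W h]] by simp
        then show ?thesis using subgroup_AutD(4)[OF W h k(1)] unfolding U_def by blast
      qed
      show "h x \<in> U a \<longleftrightarrow> x \<in> U a" if "h \<in> W" for h x
        using sub[OF that] sub[OF subgroup_AutD(5)[OF W that], of "h x"]
          subgroup_AutD(7)[OF W that] by auto
      show "g \<in> G" using g by (simp add: Rist_def)
      \<comment> \<open>Here the triviality of \<open>Rist T W v\<close> enters: it passes to the
        descendant \<open>a\<close>, while \<open>g\<close> is not the identity.\<close>
      show "g \<notin> W"
      proof
        assume "g \<in> W"
        then have "g \<in> Rist T W a" using g by (simp add: Rist_def)
        then show False using Rist_mono[OF T a] v g by blast
      qed
      show "g x = x" if "x \<notin> U a" for x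
        using that g subgroup_AutD(1)[OF W] by (force simp: Rist_def U_def)
    qed
  qed
  have "bounded_orbits T W UNIV"
  proof (cases "\<exists>a\<in>subtree T v. \<exists>b\<in>subtree T v. level T a = level T b \<and>
      vertex_orbit W a \<noteq> vertex_orbit W b")
    case True
    then obtain a b where ab: "a \<in> subtree T v" "b \<in> subtree T v" "level T a = level T b"
      "vertex_orbit W a \<noteq> vertex_orbit W b" by blast
    \<comment> \<open>A common vertex would lie below translates of \<open>a\<close> and
      \<open>b\<close>. These have equal level, hence coincide, which would put \<open>a\<close> and
      \<open>b\<close> in one orbit.\<close>
    have "x \<notin> U a \<or> x \<notin> U b" for x
    proof (rule ccontr)
      assume "\<not> ?thesis"
      then obtain h k where hk: "h \<in> W" "x \<in> subtree T (h a)" "k \<in> W" "x \<in> subtree T (k b)"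
        by (auto simp: U_def)
      have "level T (h a) = level T (k b)"
        using ab(3) level_Aut[OF T] subgroup_AutD(2)[OF W] hk by metis
      then have "h a = k b" using subtree_disjoint[OF T] hk by blast
      then show False using ab(4) vertex_orbit_eq[OF W] hk by metis
    qed
    then have "- U a \<union> - U b = UNIV" by auto
    then show ?thesis using bounded_orbits_Un[OF U[OF ab(1)] U[OF ab(2)]] by simp
  next
    case False
    \<comment> \<open>Each vertex of \<open>U v\<close> can be moved by \<open>W\<close> into the
      subtree of \<open>v\<close>, where in this case vertices of equal level share an
      orbit.\<close>
    have "vertex_orbit W x = vertex_orbit W y"
      if x: "x \<in> level_set T n \<inter> U v" and y: "y \<in> level_set T n \<inter> U v" for n x y
    proof -
      have rep: "\<exists>z\<in>subtree T v. level T z = n \<and> vertex_orbit W z = vertex_orbit W x"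
        if "x \<in> level_set T n \<inter> U v" for x
      proof -
        obtain h where h: "h \<in> W" "x \<in> subtree T (h v)" using \<open>x \<in> _\<close> by (auto simp: U_def)
        let ?z = "inv_into UNIV h x"
        have hz: "h ?z = x" by (rule subgroup_AutD(6)[OF W h(1)])
        have "?z \<in> subtree T v"
          using subtree_Aut[OF T subgroup_AutD(2)[OF W h(1)], of ?z v] hz h by simp
        moreover have "level T ?z = n"
          using level_Aut[OF T subgroup_AutD(2)[OF W h(1)], of ?z] hz that
          by (simp add: level_set_def)
        moreover have "vertex_orbit W ?z = vertex_orbit W x"
          using vertex_orbit_eq[OF W h(1), of ?z] hz by simp
        ultimately show ?thesis by blast
      qed
      show ?thesis using rep[OF x] rep[OF y] False by metis
    qed
    then have sub: "vertex_orbit W ` (level_set T n \<inter> U v) \<subseteq> {vertex_orbit W x}"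
      if "x \<in> level_set T n \<inter> U v" for n x using that by blast
    have "finite (vertex_orbit W ` (level_set T n \<inter> U v)) \<and>
        card (vertex_orbit W ` (level_set T n \<inter> U v)) \<le> 1" for n
    proof (cases "level_set T n \<inter> U v = {}")
      case False
      then obtain x where "x \<in> level_set T n \<inter> U v" by blast
      note s = sub[OF this]
      show ?thesis using finite_subset[OF s] card_mono[OF _ s] by simp
    qed simp
    then have "bounded_orbits T W (U v)" unfolding bounded_orbits_def by blast
    \<comment> \<open>At most one orbit per level meets \<open>U v\<close>; the bound on the
      complement is the case \<open>a = v\<close> of the bound for \<open>U a\<close>.\<close>
    then have "bounded_orbits T W (U v \<union> - U v)"
      using U[OF self_in_subtree[OF T]] by (rule bounded_orbits_Un)
    then show ?thesis by simp
  qed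
  then show "finite (orbit_closures T W)" by (rule finite_orbit_closures[OF T W])
qed

end
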